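(* Let $\mathbb{Q}$ be the law of a translation-invariant, finite-range self-interacting random walk on $\mathbb{Z}^d$ started at the origin, let $c_n(x)=\mathbb{Q}(\omega_n=x)$, let $D(x)=\mathbb{Q}(\omega_1=x)$, and let $\{\pi_m\}_{m\ge 2}$ be the expansion coefficients defined in the context. Then for every $n\ge 0$ and every $x\in\mathbb{Z}^d$, $$c_{n+1}(x)=\sum_{y\in\mathbb{Z}^d} D(y)\,c_n(x-y)+\sum_{y\in\mathbb{Z}^d}\sum_{m=2}^{n+1}\pi_m(y)\,c_{n+1-m}(x-y).$$
   Context: Self-interacting random walk. A finite path is $\vec{x}_i=(x_0,\dots,x_i)$ with $x_j\in\mathbb{Z}^d$. For every finite path $\vec{x}_i$ a probability mass function $y\mapsto p^{\vec{x}_i}(x_i,y)$ on $\mathbb{Z}^d$ is given (the conditional probability of stepping from $x_i$ to $y$ given the history $\vec{x}_i$). It is translation invariant, i.e. unchanged when the whole path and $y$ are shifted by the same vector, and has finite range $L<\infty$, i.e. $p^{\vec{x}_i}(x_i,y)=0$ if $|y-x_i|>L$. The walk $\vec\omega=(\omega_0,\omega_1,\dots)$ started at the origin $o$ has law $\mathbb{Q}$ given by $\mathbb{Q}(\vec\omega_n=(x_0,\dots,x_n))=\prod_{i=0}^{n-1}p^{\vec{x}_i}(x_i,x_{i+1})$ for $x_0=o$, where $\vec\omega_n=(\omega_0,\dots,\omega_n)$. Thus $D(x)=p^{o}(o,x)$ and $c_0(x)=1$ if $x=o$, $c_0(x)=0$ otherwise. Concatenation. If $\vec\eta_j=(\eta_0,\dots,\eta_j)$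 and $\vec{x}_m=(x_0,\dots,x_m)$ with $\eta_j=x_0$, then $\vec\eta_j\circ\vec{x}_m=(\eta_0,\dots,\eta_j,x_1,\dots,x_m)$. Expansion coefficients. For $N\ge1$ and $m\ge 2$ let $\mathcal{A}_{m,N}=\{(j_1,\dots,j_N)\in\mathbb{Z}_{\ge0}^N: j_1+\dots+j_N=m-N-1\}$ and set $j_0=0$. For $\vec{j}\in\mathcal{A}_{m,N}$ consider paths $\vec\omega^{(0)}_1=(o,\omega^{(0)}_1)$ and, for $n=1,\dots,N$, $\vec\omega^{(n)}_{j_n+1}=(\omega^{(n)}_0,\dots,\omega^{(n)}_{j_n+1})$ with $\omega^{(n)}_0=\omega^{(n-1)}_{j_{n-1}+1}$; $\vec\omega^{(n)}_i$ denotes the first $i$ steps of $\vec\omega^{(n)}_{j_n+1}$. Put $$\Delta^{(n)}_{j_n+1}=\Big(p^{\vec\omega^{(n-1)}_{j_{n-1}+1}\circ\vec\omega^{(n)}_{j_n}}-p^{\vec\omega^{(n)}_{j_n}}\Big)\big(\omega^{(n)}_{j_n},\omega^{(n)}_{j_n+1}\big),$$ $$\pi_m^{(N)}(y)=\sum_{\vec{j}\in\mathcal{A}_{m,N}}\ \sum_{\vec\omega^{(0)}_1}\sum_{\vec\omega^{(1)}_{j_1+1}}\cdots\sum_{\vec\omega^{(N)}_{j_N+1}} I_{\{\omega^{(N)}_{j_N+1}=y\}}\,D(\omega^{(0)}_1)\prod_{n=1}^N\Delta^{(n)}_{j_n+1}\prod_{i=0}^{j_n-1}p^{\vec\omega^{(n-1)}_{j_{n-1}+1}\circ\vec\omega^{(n)}_{i}}\big(\omega^{(n)}_i,\omega^{(n)}_{i+1}\big),$$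 the sums being over all such paths and empty products being $1$. Finally $\pi_m(y)=\sum_{N=1}^\infty\pi_m^{(N)}(y)$ (the terms with $N+1>m$ vanish). *)

theory Defs
  imports "HOL-Probability.Probability"
begin

type_synonym 'd site = "int ^ 'd"

text \<open>
  A finite path \<open>(x\<^sub>0, \<dots>, x\<^sub>i)\<close> is the nonempty list of the \<open>i + 1\<close> sites it visits.
  A family of kernels \<open>p\<close> takes such a history \<open>xs\<close> and a site \<open>y\<close>; the point from which the
  step is made is always \<open>last xs\<close>, so it is not a separate argument. Values on the
  empty list are irrelevant.
\<close>

type_synonym 'd path = "'d site list"
type_synonym 'd kernels = "'d path \<Rightarrow> 'd site \<Rightarrow> real"

definition is_kernels :: "('d::finite) kernels \<Rightarrow> bool" where
  "is_kernels p \<longleftrightarrow> (\<forall>xs. xs \<noteq> [] \<longrightarrow> (\<forall>y. 0 \<le> p xs y) \<and> (p xs has_sum 1) UNIV)"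

definition translation_invariant :: "('d::finite) kernels \<Rightarrow> bool" where
  "translation_invariant p \<longleftrightarrow>
     (\<forall>xs y v. xs \<noteq> [] \<longrightarrow> p (map (\<lambda>z. z + v) xs) (y + v) = p xs y)"

definition site_norm :: "('d::finite) site \<Rightarrow> real" where
  "site_norm x = norm (\<chi> i. real_of_int (x $ i))"

definition finite_range :: "real \<Rightarrow> ('d::finite) kernels \<Rightarrow> bool" where
  "finite_range L p \<longleftrightarrow> (\<forall>xs y. xs \<noteq> [] \<longrightarrow> L < site_norm (y - last xs) \<longrightarrow> p xs y = 0)"

text \<open>
  Taking \<open>xs = [0]\<close> in the last condition gives probability 1 to \<open>\<omega> 0 = 0\<close>, so paths that
  do not start at the origin need no separate clause.
\<close>

definition is_walk_law :: "('d::finite) kernels \<Rightarrow> (nat \<Rightarrow> 'd site) measure \<Rightarrow> bool" where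
  "is_walk_law p Q \<longleftrightarrow>
     prob_space Q \<and>
     sets Q = sets (PiM UNIV (\<lambda>_. count_space UNIV)) \<and>
     (\<forall>xs. xs \<noteq> [] \<longrightarrow> hd xs = 0 \<longrightarrow>
        measure Q {\<omega> \<in> space Q. \<forall>i<length xs. \<omega> i = xs ! i} =
          (\<Prod>i<length xs - 1. p (take (Suc i) xs) (xs ! Suc i)))"

definition two_point :: "(nat \<Rightarrow> ('d::finite) site) measure \<Rightarrow> nat \<Rightarrow> 'd site \<Rightarrow> real" where
  "two_point Q n x = measure Q {\<omega> \<in> space Q. \<omega> n = x}"

definition step_distr :: "(nat \<Rightarrow> ('d::finite) site) measure \<Rightarrow> 'd site \<Rightarrow> real" where
  "step_distr Q x = measure Q {\<omega> \<in> space Q. \<omega> 1 = x}"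

text \<open>Meaningful when \<open>last xs = hd ys\<close>.\<close>

definition path_concat :: "('d::finite) path \<Rightarrow> 'd path \<Rightarrow> 'd path" where
  "path_concat xs ys = xs @ tl ys"

definition initial_path :: "nat \<Rightarrow> ('d::finite) path \<Rightarrow> 'd path" where
  "initial_path i xs = take (Suc i) xs"

text \<open>
  The indices \<open>(j\<^sub>1, \<dots>, j\<^sub>N)\<close> form a list of length \<open>N\<close>. The constraint is stated without
  subtraction, so that the set is empty for \<open>m < N + 1\<close>.
\<close>

definition index_set :: "nat \<Rightarrow> nat \<Rightarrow> nat list set" where
  "index_set m N = {js. length js = N \<and> sum_list js + N + 1 = m}"

text \<open>\<open>idx js n\<close> is \<open>j\<^sub>n\<close> for \<open>n \<le> N\<close>, with \<open>j\<^sub>0 = 0\<close>.\<close>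

definition idx :: "nat list \<Rightarrow> nat \<Rightarrow> nat" where
  "idx js n = (0 # js) ! n"

text \<open>
  The tuples \<open>(\<omega>\<^sup>(\<^sup>0\<^sup>), \<dots>, \<omega>\<^sup>(\<^sup>N\<^sup>))\<close> of paths summed over: \<open>ws ! n\<close> makes \<open>j\<^sub>n + 1\<close> steps, hence
  has \<open>j\<^sub>n + 2\<close> sites.
\<close>

definition path_tuples :: "nat \<Rightarrow> nat list \<Rightarrow> ('d::finite) path list set" where
  "path_tuples N js = {ws. length ws = N + 1 \<and>
     (\<forall>n\<le>N. length (ws ! n) = idx js n + 2) \<and>
     hd (ws ! 0) = 0 \<and>
     (\<forall>n\<in>{1..N}. hd (ws ! n) = last (ws ! (n - 1)))}"

definition Delta :: "('d::finite) kernels \<Rightarrow> nat list \<Rightarrow> 'd path list \<Rightarrow> nat \<Rightarrow> real" where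
  "Delta p js ws n =
     p (path_concat (ws ! (n - 1)) (initial_path (idx js n) (ws ! n))) (ws ! n ! (idx js n + 1))
     - p (initial_path (idx js n) (ws ! n)) (ws ! n ! (idx js n + 1))"

text \<open>
  The sum over path tuples is over an infinite set, but for finite-range kernels only
  finitely many terms are nonzero.
\<close>

definition pi_N ::
  "('d::finite) kernels \<Rightarrow> (nat \<Rightarrow> 'd site) measure \<Rightarrow> nat \<Rightarrow> nat \<Rightarrow> 'd site \<Rightarrow> real" where
  "pi_N p Q N m y =
     (\<Sum>js\<in>index_set m N. \<Sum>\<^sub>\<infinity>ws\<in>path_tuples N js.
        (if last (ws ! N) = y then 1 else 0) * step_distr Q (ws ! 0 ! 1) *
        (\<Prod>n=1..N. Delta p js ws n *
           (\<Prod>i<idx js n. p (path_concat (ws ! (n - 1)) (initial_path i (ws ! n)))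
                            (ws ! n ! (i + 1)))))"

definition pi_coeff ::
  "('d::finite) kernels \<Rightarrow> (nat \<Rightarrow> 'd site) measure \<Rightarrow> nat \<Rightarrow> 'd site \<Rightarrow> real" where
  "pi_coeff p Q m y = (\<Sum>\<^sub>\<infinity>N\<in>{1..}. pi_N p Q N m y)"

lemma step_distr_eq_kernel:
  assumes "is_walk_law p Q"
  shows "step_distr Q x = p [0] x"
proof -
  interpret prob_space Q using assms by (simp add: is_walk_law_def)
  have sQ: "sets Q = sets (PiM UNIV (\<lambda>_. count_space UNIV))"
    using assms by (simp add: is_walk_law_def)
  have m: "{\<omega> \<in> space Q. \<omega> n = z} \<in> sets Q" for n z
  proof -
    have "(\<lambda>\<omega>. \<omega> n) \<in> measurable Q (count_space UNIV)"
      by (subst measurable_cong_sets[OF sQ refl]) simp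
    from measurable_sets[OF this, of "{z}"] show ?thesis
      by (simp add: vimage_def Int_def conj_commute)
  qed
  have law: "measure Q {\<omega> \<in> space Q. \<forall>i<length xs. \<omega> i = xs ! i} =
          (\<Prod>i<length xs - 1. p (take (Suc i) xs) (xs ! Suc i))"
    if "xs \<noteq> []" "hd xs = 0" for xs
    using assms that by (simp add: is_walk_law_def)
  have "prob {\<omega> \<in> space Q. \<omega> 0 = 0} = 1"
    using law[of "[0]"] by simp
  then have "AE \<omega> in Q. \<omega> 0 = 0"
    using prob_Collect_eq_1[OF m[of 0 0]] by simp
  then have "prob {\<omega> \<in> space Q. \<omega> 1 = x} = prob {\<omega> \<in> space Q. \<omega> 0 = 0 \<and> \<omega> 1 = x}"
    using m[of 1 x] sets.sets_Collect_conj[OF m[of 0 0] m[of 1 x]]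
    by (intro finite_measure_eq_AE) (auto simp: conj_commute)
  also have "\<dots> = p [0] x"
    using law[of "[0, x]"] by (simp add: All_less_Suc2)
  finally show ?thesis by (simp add: step_distr_def)
qed

end

theory Submission
  imports Defs
begin

text \<open>
  Compare the walk that has a history \<open>\<eta>\<close> ending at \<open>z\<close> with the walk started afresh at \<open>z\<close>. The
  probability of a continuation is a product of kernels \<open>a\<^sub>0 a\<^sub>1 \<cdots>\<close> in the first case and
  \<open>b\<^sub>0 b\<^sub>1 \<cdots>\<close> in the second, and telescoping gives
  \[ \prod_i a_i = \prod_i b_i + \sum_j \Big(\prod_{i<j} a_i\Big) (a_j - b_j) \prod_{i>j} b_i. \]
  The trailing product of the \<open>b\<^sub>i\<close> is again the law of a walk with a history, namely the fresh
  piece of path made of its first \<open>j + 1\<close> steps: everything before \<open>z\<close> has been forgotten. This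
  is \<open>expect_change_history\<close>. Applying the comparison again to each of those walks, until no steps
  are left, writes an expectation with history \<open>\<eta>\<close> as a sum over lists \<open>(j\<^sub>1, \<dots>, j\<^sub>N)\<close>, each term
  being a chain of \<open>N\<close> switches followed by a walk with no history at all (\<open>expect_expansion\<close>).

  Take for \<open>\<eta>\<close> the first step \<open>(0, a)\<close> of the walk and average over \<open>a\<close>. The empty list gives the
  term with \<open>D\<close>. A nonempty list gives a summand of \<open>\<pi>\<^sub>m\<close>, where \<open>m\<close> is the number of
  steps that it uses up, the first step included; translation invariance turns the remaining walk
  from \<open>y\<close> to \<open>x\<close> into \<open>c (x - y)\<close>.

  What remains is to identify the infinite sums with finite ones. Since the range is finite, all sums over
  paths reduce to finite sets \<open>walks\<close>. A tuple of paths in which some path makes too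
  long a step has weight zero (\<open>switch_weight_outside\<close>), so the sum defining \<open>pi_N\<close> collapses to
  an iterated finite sum (\<open>infsum_path_tuples\<close>). On the side of the law, the cylinder events of the paths in
  \<open>walks\<close> are disjoint with total probability one, which makes the two-point function a finite
  path sum (\<open>two_point_eq_expect\<close>).
\<close>

section \<open>Auxiliary facts on sums\<close>

lemma has_sum_finite_sum:
  fixes f :: "'a \<Rightarrow> 'b \<Rightarrow> 'c::topological_comm_monoid_add"
  assumes "finite I" "\<And>i. i \<in> I \<Longrightarrow> (f i has_sum s i) A"
  shows "((\<lambda>x. \<Sum>i\<in>I. f i x) has_sum (\<Sum>i\<in>I. s i)) A"
  using assms by (induction I rule: finite_induct) (auto intro: has_sum_add)

lemma sum_UN_Cons:
  assumes "finite A" "\<And>a. a \<in> A \<Longrightarrow> finite (B a)"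
  shows "sum h (\<Union>a\<in>A. (#) a ` B a) = (\<Sum>a\<in>A. \<Sum>b\<in>B a. h (a # b))"
proof -
  have "sum h (\<Union>a\<in>A. (#) a ` B a) = (\<Sum>a\<in>A. sum h ((#) a ` B a))"
    by (rule sum.UNION_disjoint) (use assms in auto)
  then show ?thesis by (simp add: sum.reindex)
qed

section \<open>Finite-range paths\<close>

definition nbhd :: "real \<Rightarrow> ('d::finite) site \<Rightarrow> 'd site set" where
  "nbhd L z = {a. site_norm (a - z) \<le> L}"

text \<open>
  Each coordinate of a displacement is bounded by the norm, so displacements inject into functions
  from the finite index type to a bounded integer interval.
\<close>

lemma finite_nbhd [simp]: "finite (nbhd L z)"
proof -
  define M where "M = \<lceil>L\<rceil>"
  have "(\<lambda>a. vec_nth (a - z)) ` nbhd L z \<subseteq> (UNIV \<rightarrow>\<^sub>E {- M..M})"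
  proof clarify
    fix a assume "a \<in> nbhd L z"
    have "(a - z) $ i \<in> {- M..M}" for i
    proof -
      have "\<bar>real_of_int ((a - z) $ i)\<bar> \<le> L"
        using component_le_norm_cart[of "\<chi> i. real_of_int ((a - z) $ i)" i] \<open>a \<in> nbhd L z\<close>
        by (simp add: site_norm_def nbhd_def)
      then show ?thesis
        unfolding M_def atLeastAtMost_iff by linarith
    qed
    then show "vec_nth (a - z) \<in> UNIV \<rightarrow>\<^sub>E {- M..M}"
      by (simp only: PiE_UNIV_domain Pi_iff) simp
  qed
  moreover have "inj_on (\<lambda>a. vec_nth (a - z)) (nbhd L z)"
    by (auto simp: inj_on_def vec_eq_iff fun_eq_iff)
  moreover have "finite (UNIV \<rightarrow>\<^sub>E {- M..M} :: ('a \<Rightarrow> int) set)"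
    by (rule finite_PiE) auto
  ultimately show ?thesis
    using finite_subset finite_imageD by blast
qed

primrec walks :: "real \<Rightarrow> nat \<Rightarrow> ('d::finite) site \<Rightarrow> 'd path set" where
  "walks L 0 z = {[z]}"
| "walks L (Suc k) z = (\<Union>a\<in>nbhd L z. (#) z ` walks L k a)"

lemma finite_walks [simp]: "finite (walks L k z)"
  by (induction k arbitrary: z) auto

lemma walks_iff:
  "v \<in> walks L k z \<longleftrightarrow> length v = Suc k \<and> hd v = z \<and> (\<forall>i<k. v ! Suc i \<in> nbhd L (v ! i))"
proof (induction k arbitrary: z v)
  case 0
  then show ?case by (cases v) auto
next
  case (Suc k)
  show ?case
  proof (cases v)
    case (Cons b v')
    show ?thesis
    proof (cases v')
      case (Cons a v'')
      then show ?thesis using \<open>v = b # v'\<close>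
        by (auto simp: Suc.IH image_iff All_less_Suc2)
    qed (use Cons in \<open>auto simp: Suc.IH\<close>)
  qed auto
qed

lemma length_walks: "v \<in> walks L k z \<Longrightarrow> length v = Suc k"
  and hd_walks: "v \<in> walks L k z \<Longrightarrow> hd v = z"
  by (simp_all add: walks_iff)

lemma walks_nonempty: "v \<in> walks L k z \<Longrightarrow> v \<noteq> []"
  using length_walks by fastforce

lemma walks_eq_Cons: "v \<in> walks L k z \<Longrightarrow> v = z # tl v"
  by (metis hd_walks list.collapse walks_nonempty)

lemma sum_walks_Suc: "sum h (walks L (Suc k) z) = (\<Sum>a\<in>nbhd L z. \<Sum>v\<in>walks L k a. h (z # v))"
proof -
  have "sum h (walks L (Suc k) z) = (\<Sum>a\<in>nbhd L z. sum h ((#) z ` walks L k a))"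
    unfolding walks.simps by (rule sum.UNION_disjoint) (auto dest: hd_walks)
  then show ?thesis by (simp add: sum.reindex)
qed

lemma nbhd_shift: "nbhd L (z + v) = (\<lambda>a. a + v) ` nbhd L z"
proof -
  have "a = (a - v) + v" "a - v - z = a - (z + v)" for a by simp_all
  then show ?thesis unfolding nbhd_def image_def
    by (smt (verit, best) Collect_cong mem_Collect_eq add_diff_cancel_right')
qed

section \<open>Expectations along a walk with a given history\<close>

locale finite_range_kernels =
  fixes p :: "('d::finite) kernels" and L :: real
  assumes is_kernels: "is_kernels p" and finite_range: "finite_range L p"
begin

lemma kernel_outside: "\<eta> \<noteq> [] \<Longrightarrow> a \<notin> nbhd L (last \<eta>) \<Longrightarrow> p \<eta> a = 0"
  using finite_range by (auto simp: finite_range_def nbhd_def)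

lemma sum_kernel: "\<eta> \<noteq> [] \<Longrightarrow> (\<Sum>a\<in>nbhd L (last \<eta>). p \<eta> a) = 1"
proof -
  assume ne: "\<eta> \<noteq> []"
  then have "(p \<eta> has_sum 1) UNIV"
    using is_kernels by (simp add: is_kernels_def)
  then have "(p \<eta> has_sum 1) (nbhd L (last \<eta>))"
    by (subst has_sum_cong_neutral[where T = UNIV and g = "p \<eta>"]) (use ne kernel_outside in auto)
  then show ?thesis by (meson finite_nbhd has_sum_finite has_sum_unique)
qed

text \<open>
  The expectation of \<open>f\<close> at the position reached after \<open>n\<close> more steps, given the history \<open>\<eta>\<close>.
  An arbitrary observable \<open>f\<close>, rather than the indicator of an endpoint, lets the expansion below be
  iterated and lets translations act on \<open>f\<close>.
\<close>

primrec expect :: "nat \<Rightarrow> 'd path \<Rightarrow> ('d site \<Rightarrow> real) \<Rightarrow> real" where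
  "expect 0 \<eta> f = f (last \<eta>)"
| "expect (Suc n) \<eta> f = (\<Sum>a\<in>nbhd L (last \<eta>). p \<eta> a * expect n (\<eta> @ [a]) f)"

text \<open>
  The path \<open>v\<close> starts at the last site of \<open>\<eta>\<close>, hence the \<open>tl\<close> when it is appended to \<open>\<eta>\<close>. Only
  the first \<open>k\<close> steps of \<open>v\<close> count.
\<close>

definition continuation_prob :: "nat \<Rightarrow> 'd path \<Rightarrow> 'd path \<Rightarrow> real" where
  "continuation_prob k \<eta> v = (\<Prod>i<k. p (\<eta> @ take i (tl v)) (v ! Suc i))"

lemma continuation_prob_Suc:
  assumes "v = a # tl v"
  shows "continuation_prob (Suc k) \<eta> (z # v) = p \<eta> a * continuation_prob k (\<eta> @ [a]) v"
proof -
  have *: "take (Suc i) v = a # take i (tl v)" "v ! 0 = a" for i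
    using assms by (metis take_Suc_Cons, metis nth_Cons_0)
  show ?thesis
    unfolding continuation_prob_def prod.lessThan_Suc_shift by (simp add: *)
qed

lemma expect_eq_sum_walks:
  "expect n \<eta> f = (\<Sum>v\<in>walks L n (last \<eta>). continuation_prob n \<eta> v * f (last v))"
proof (induction n arbitrary: \<eta>)
  case 0
  then show ?case by (simp add: continuation_prob_def)
next
  case (Suc n)
  have "continuation_prob (Suc n) \<eta> (z # v) * f (last (z # v))
      = p \<eta> a * (continuation_prob n (\<eta> @ [a]) v * f (last v))"
    if "v \<in> walks L n a" for a v z
    using that walks_eq_Cons[OF that] walks_nonempty[OF that]
    by (simp add: continuation_prob_Suc)
  then show ?case
    unfolding sum_walks_Suc by (simp add: Suc.IH sum_distrib_left)
qed

lemma expect_one: "\<eta> \<noteq> [] \<Longrightarrow> expect n \<eta> (\<lambda>_. 1) = 1"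
  by (induction n arbitrary: \<eta>) (simp_all add: sum_kernel)

lemma expect_shift:
  assumes "translation_invariant p" "\<eta> \<noteq> []"
  shows "expect n (map (\<lambda>z. z + v) \<eta>) f = expect n \<eta> (\<lambda>z. f (z + v))"
  using assms(2)
proof (induction n arbitrary: \<eta>)
  case 0
  then show ?case by (simp add: last_map)
next
  case (Suc n)
  have "expect (Suc n) (map (\<lambda>z. z + v) \<eta>) f
     = (\<Sum>a\<in>nbhd L (last \<eta>). p (map (\<lambda>z. z + v) \<eta>) (a + v)
           * expect n (map (\<lambda>z. z + v) (\<eta> @ [a])) f)"
    using Suc.prems by (simp add: last_map nbhd_shift sum.reindex)
  also have "\<dots> = expect (Suc n) \<eta> (\<lambda>z. f (z + v))"
    using assms(1) Suc.prems
    by (auto simp: translation_invariant_def Suc.IH simp del: map_append intro!: sum.cong)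
  finally show ?case .
qed

section \<open>Changing the history\<close>

text \<open>
  The path \<open>v\<close> follows history \<open>\<eta>\<close> for \<open>j\<close> steps, and its step number \<open>j + 1\<close> is the one at which
  the telescoping sum passes from \<open>\<eta>\<close> to \<open>\<eta>'\<close>. With \<open>\<eta>' = [last \<eta>]\<close> this is the factor
  \<open>\<Delta> \<cdot> \<Prod> p\<close> in the definition of the coefficients.
\<close>

definition switch_weight :: "nat \<Rightarrow> 'd path \<Rightarrow> 'd path \<Rightarrow> 'd path \<Rightarrow> real" where
  "switch_weight j \<eta> \<eta>' v =
     (p (\<eta> @ take j (tl v)) (v ! Suc j) - p (\<eta>' @ take j (tl v)) (v ! Suc j)) *
     continuation_prob j \<eta> v"

text \<open>
  Telescoping by induction on \<open>n\<close>. Splitting off the first step, to \<open>a\<close> say, the difference of the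
  first kernels contributes the term \<open>j = 0\<close>; otherwise the step is taken with \<open>p \<eta>\<close>
  and the histories \<open>\<eta> @ [a]\<close> and \<open>\<eta>' @ [a]\<close> are compared. The history \<open>\<eta>'\<close> has to
  be general because it becomes longer with each step of this induction.
\<close>

lemma expect_change_history:
  assumes "\<eta> \<noteq> []" "\<eta>' \<noteq> []" "last \<eta> = last \<eta>'"
  shows "expect n \<eta> f = expect n \<eta>' f +
    (\<Sum>j<n. \<Sum>v\<in>walks L (Suc j) (last \<eta>). switch_weight j \<eta> \<eta>' v * expect (n - Suc j) (\<eta>' @ tl v) f)"
  using assms
proof (induction n arbitrary: \<eta> \<eta>')
  case 0
  then show ?case by simp
next
  case (Suc n)
  let ?N = "nbhd L (last \<eta>)"
  let ?S = "\<lambda>j a. \<Sum>v\<in>walks L (Suc j) a. switch_weight j (\<eta> @ [a]) (\<eta>' @ [a]) v *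
               expect (n - Suc j) (\<eta>' @ [a] @ tl v) f"
  have first: "(\<Sum>v\<in>walks L (Suc 0) (last \<eta>).
      switch_weight 0 \<eta> \<eta>' v * expect (Suc n - Suc 0) (\<eta>' @ tl v) f)
    = (\<Sum>a\<in>?N. (p \<eta> a - p \<eta>' a) * expect n (\<eta>' @ [a]) f)"
    unfolding sum_walks_Suc by (simp add: switch_weight_def continuation_prob_def)
  have later: "(\<Sum>v\<in>walks L (Suc (Suc j)) (last \<eta>).
      switch_weight (Suc j) \<eta> \<eta>' v * expect (Suc n - Suc (Suc j)) (\<eta>' @ tl v) f)
    = (\<Sum>a\<in>?N. p \<eta> a * ?S j a)" for j
  proof -
    have "switch_weight (Suc j) \<eta> \<eta>' (z # v) * expect (Suc n - Suc (Suc j)) (\<eta>' @ tl (z # v)) f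
      = p \<eta> a * (switch_weight j (\<eta> @ [a]) (\<eta>' @ [a]) v * expect (n - Suc j) (\<eta>' @ [a] @ tl v) f)"
      if v: "v \<in> walks L (Suc j) a" for a v z
    proof -
      have "take (Suc j) v = a # take j (tl v)" "\<eta>' @ v = \<eta>' @ [a] @ tl v"
        using walks_eq_Cons[OF v] by (metis take_Suc_Cons, simp)
      then show ?thesis
        using walks_eq_Cons[OF v]
        by (simp add: switch_weight_def continuation_prob_Suc)
    qed
    then show ?thesis
      unfolding sum_walks_Suc[of _ L "Suc j"] by (simp add: sum_distrib_left)
  qed
  have "expect (Suc n) \<eta> f = (\<Sum>a\<in>?N. p \<eta> a * (expect n (\<eta>' @ [a]) f + (\<Sum>j<n. ?S j a)))"
    unfolding expect.simps by (intro sum.cong refl, subst Suc.IH[of _ "\<eta>' @ [_]"]) auto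
  also have "\<dots> = (\<Sum>a\<in>?N. p \<eta>' a * expect n (\<eta>' @ [a]) f
      + (p \<eta> a - p \<eta>' a) * expect n (\<eta>' @ [a]) f + p \<eta> a * (\<Sum>j<n. ?S j a))"
    by (intro sum.cong refl) (simp add: ring_distribs)
  also have "\<dots> = expect (Suc n) \<eta>' f
      + (\<Sum>a\<in>?N. (p \<eta> a - p \<eta>' a) * expect n (\<eta>' @ [a]) f) + (\<Sum>a\<in>?N. p \<eta> a * (\<Sum>j<n. ?S j a))"
    unfolding sum.distrib using Suc.prems by simp
  also have "(\<Sum>a\<in>?N. p \<eta> a * (\<Sum>j<n. ?S j a)) = (\<Sum>j<n. \<Sum>a\<in>?N. p \<eta> a * ?S j a)"
    unfolding sum_distrib_left[of _ _ "{..<n}"] by (rule sum.swap)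
  finally show ?case
    unfolding sum.lessThan_Suc_shift first later by (simp only: add.assoc)
qed

end

section \<open>Iterating the change of history\<close>

text \<open>
  An entry \<open>j\<close> of an index list stands for a piece of path of \<open>j + 1\<close> steps.
\<close>

abbreviation total_steps :: "nat list \<Rightarrow> nat" where
  "total_steps js \<equiv> sum_list js + length js"

definition bounded_index :: "nat \<Rightarrow> nat list set" where
  "bounded_index n = {js. total_steps js \<le> n}"

lemma finite_bounded_index [simp]: "finite (bounded_index n)"
proof (rule finite_subset)
  show "bounded_index n \<subseteq> {js. set js \<subseteq> {..n} \<and> length js \<le> n}"
  proof (clarsimp simp: bounded_index_def subset_iff)
    fix js j assume "total_steps js \<le> n" "j \<in> set js"
    then show "j \<le> n" using member_le_sum_list[of j js] by linarith
  qed
  show "finite {js. set js \<subseteq> {..n} \<and> length js \<le> n}"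
    by (rule finite_lists_length_le) simp
qed

lemma sum_bounded_index:
  fixes h :: "nat list \<Rightarrow> 'c::comm_monoid_add"
  shows "sum h (bounded_index n) = h [] + (\<Sum>j<n. \<Sum>js\<in>bounded_index (n - Suc j). h (j # js))"
proof -
  let ?U = "\<Union>j\<in>{..<n}. (#) j ` bounded_index (n - Suc j)"
  have "bounded_index n = insert [] ?U"
  proof (rule set_eqI)
    fix js
    show "js \<in> bounded_index n \<longleftrightarrow> js \<in> insert [] ?U"
      by (cases js) (auto simp: bounded_index_def image_iff)
  qed
  then have "sum h (bounded_index n) = sum h (insert [] ?U)"
    by (rule arg_cong)
  also have "\<dots> = h [] + sum h ?U" by (rule sum.insert) auto
  finally show ?thesis by (simp add: sum_UN_Cons)
qed

(* Unfolding would compete with sum_walks_Suc and walks_iff. *)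
declare walks.simps(2) [simp del]

context finite_range_kernels
begin

text \<open>
  The recursive call has history \<open>v\<close>, not \<open>\<eta>\<close> followed by \<open>v\<close>: beyond the switch only kernels of
  the fresh walk occur, and these see nothing before the start of \<open>v\<close>.
\<close>

primrec iterated_switch :: "nat list \<Rightarrow> 'd path \<Rightarrow> ('d site \<Rightarrow> real) \<Rightarrow> real" where
  "iterated_switch [] \<eta> f = f (last \<eta>)"
| "iterated_switch (j # js) \<eta> f =
     (\<Sum>v\<in>walks L (Suc j) (last \<eta>). switch_weight j \<eta> [last \<eta>] v * iterated_switch js v f)"

text \<open>
  Each term of \<open>expect_change_history\<close> other than the fresh walk carries an expectation with fewer
  steps and history \<open>v\<close>, to which the induction hypothesis applies; prepending \<open>j\<close> to the lists of that
  expansion gives the nonempty lists of this one.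
\<close>

lemma expect_expansion:
  assumes "\<eta> \<noteq> []"
  shows "expect n \<eta> f =
    (\<Sum>js\<in>bounded_index n. iterated_switch js \<eta> (\<lambda>y. expect (n - total_steps js) [y] f))"
  using assms
proof (induction n arbitrary: \<eta> rule: less_induct)
  case (less n)
  let ?z = "last \<eta>"
  have switched:
    "(\<Sum>v\<in>walks L (Suc j) ?z. switch_weight j \<eta> [?z] v * expect (n - Suc j) ([?z] @ tl v) f)
     = (\<Sum>js\<in>bounded_index (n - Suc j).
          iterated_switch (j # js) \<eta> (\<lambda>y. expect (n - total_steps (j # js)) [y] f))"
    if "j < n" for j
  proof -
    have "expect (n - Suc j) ([?z] @ tl v) f
       = (\<Sum>js\<in>bounded_index (n - Suc j).
           iterated_switch js v (\<lambda>y. expect (n - total_steps (j # js)) [y] f))"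
      if v: "v \<in> walks L (Suc j) ?z" for v
    proof -
      have eq: "[?z] @ tl v = v" using walks_eq_Cons[OF v] by simp
      have "n - Suc j - total_steps js = n - total_steps (j # js)" for js by simp
      moreover have "n - Suc j < n" using \<open>j < n\<close> by simp
      ultimately show ?thesis
        unfolding eq using less.IH[OF _ walks_nonempty[OF v]] by presburger
    qed
    then show ?thesis
      unfolding iterated_switch.simps
      by (subst sum.swap, intro sum.cong refl) (simp only: sum_distrib_left)
  qed
  have "expect n \<eta> f = expect n [?z] f + (\<Sum>j<n. \<Sum>v\<in>walks L (Suc j) ?z.
        switch_weight j \<eta> [?z] v * expect (n - Suc j) ([?z] @ tl v) f)"
    by (rule expect_change_history) (use less.prems in simp_all)
  also have "\<dots> = iterated_switch [] \<eta> (\<lambda>y. expect (n - total_steps []) [y] f)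
     + (\<Sum>j<n. \<Sum>js\<in>bounded_index (n - Suc j).
          iterated_switch (j # js) \<eta> (\<lambda>y. expect (n - total_steps (j # js)) [y] f))"
    by (intro arg_cong2[where f = "(+)"] sum.cong refl switched) simp_all
  finally show ?case
    unfolding sum_bounded_index[of _ n] .
qed

text \<open>
  Decomposition according to the final site. Having a sum over all sites \<open>y\<close>, not only over those that can be
  reached, spares any bookkeeping of supports.
\<close>

lemma iterated_switch_has_sum:
  "((\<lambda>y. iterated_switch js \<eta> (\<lambda>z. if z = y then 1 else 0) * g y) has_sum iterated_switch js \<eta> g) UNIV"
proof (induction js arbitrary: \<eta>)
  case Nil
  have "((\<lambda>y. (if last \<eta> = y then 1 else 0) * g y) has_sum g (last \<eta>)) {last \<eta>}"
    by (rule has_sum_finiteI) auto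
  then show ?case
    by (subst has_sum_cong_neutral[where T = "{last \<eta>}"]) auto
next
  case (Cons j js)
  show ?case
    unfolding iterated_switch.simps sum_distrib_right mult.assoc
    by (rule has_sum_finite_sum[OF finite_walks], rule has_sum_cmult_right, rule Cons.IH)
qed

section \<open>The coefficients as iterated finite sums\<close>

primrec linked_walks :: "nat list \<Rightarrow> 'd site \<Rightarrow> 'd path list set" where
  "linked_walks [] z = {[]}"
| "linked_walks (j # js) z = (\<Union>v\<in>walks L (Suc j) z. (#) v ` linked_walks js (last v))"

lemma finite_linked_walks [simp]: "finite (linked_walks js z)"
  by (induction js arbitrary: z) auto

lemma linked_walks_iff:
  "ws \<in> linked_walks js (last w) \<longleftrightarrow>
     length ws = length js \<and> (\<forall>n<length js. ws ! n \<in> walks L (Suc (js ! n)) (last ((w # ws) ! n)))"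
proof (induction js arbitrary: w ws)
  case Nil
  then show ?case by simp
next
  case (Cons j js)
  then show ?case
    by (cases ws) (auto simp: image_iff All_less_Suc2)
qed

text \<open>
  The list \<open>ws\<close> has one more entry than \<open>js\<close>: its head is the history of the first switch.
\<close>

definition tuple_weight :: "nat list \<Rightarrow> 'd path list \<Rightarrow> real" where
  "tuple_weight js ws =
     (\<Prod>n<length js. switch_weight (js ! n) (ws ! n) [last (ws ! n)] (ws ! Suc n))"

lemma tuple_weight_Cons:
  "tuple_weight (j # js) (w # v # ws) = switch_weight j w [last w] v * tuple_weight js (v # ws)"
  unfolding tuple_weight_def list.size(4) add_Suc_right add_0_right prod.lessThan_Suc_shift by simp

lemma iterated_switch_eq_sum:
  "iterated_switch js w f =
     (\<Sum>ws\<in>linked_walks js (last w). tuple_weight js (w # ws) * f (last (last (w # ws))))"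
proof (induction js arbitrary: w)
  case Nil
  then show ?case by (simp add: tuple_weight_def)
next
  case (Cons j js)
  have "last (w # v # ws) = last (v # ws)" for v ws by simp
  then show ?case
    unfolding iterated_switch.simps linked_walks.simps Cons.IH
    by (subst sum_UN_Cons) (simp_all only: finite_walks finite_linked_walks tuple_weight_Cons
        sum_distrib_left mult.assoc)
qed

text \<open>
  Both kernels in the difference, and all the kernels in the product, are evaluated at histories that
  end at the current site of \<open>v\<close>, so a single step beyond the range kills the weight.
\<close>

lemma switch_weight_outside:
  assumes "\<eta> \<noteq> []" "length v = j + 2" "hd v = last \<eta>" "v \<notin> walks L (Suc j) (last \<eta>)"
  shows "switch_weight j \<eta> [last \<eta>] v = 0"
proof -
  obtain i where i: "i < Suc j" "v ! Suc i \<notin> nbhd L (v ! i)"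
    using assms by (auto simp: walks_iff)
  have v: "v = last \<eta> # tl v" using assms by (cases v) auto
  have *: "last (\<eta>' @ take i (tl v)) = v ! i" if "\<eta>' \<noteq> []" "last \<eta>' = last \<eta>" for \<eta>'
  proof (cases i)
    case 0
    then show ?thesis using v that by (metis append_Nil2 nth_Cons_0 take_0)
  next
    case (Suc k)
    have "k < length (tl v)" using i Suc assms(2) by simp
    then show ?thesis using Suc
      by (subst v) (simp add: take_Suc_conv_app_nth)
  qed
  have zero: "p (\<eta>' @ take i (tl v)) (v ! Suc i) = 0" if "\<eta>' \<noteq> []" "last \<eta>' = last \<eta>" for \<eta>'
    using i *[OF that] that kernel_outside[of "\<eta>' @ take i (tl v)" "v ! Suc i"] by simp
  show ?thesis
  proof (cases "i = j")
    case True
    then show ?thesis using zero[of \<eta>] zero[of "[last \<eta>]"] assms(1)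
      by (simp add: switch_weight_def)
  next
    case False
    then have "i < j" using i by simp
    then have "continuation_prob j \<eta> v = 0"
      using zero[of \<eta>] assms(1) by (auto simp: continuation_prob_def)
    then show ?thesis by (simp add: switch_weight_def)
  qed
qed

lemma path_tuples_Cons:
  assumes "length js = N"
  shows "w # ws \<in> path_tuples N js \<longleftrightarrow> length w = 2 \<and> hd w = 0 \<and> length ws = N \<and>
    (\<forall>n<N. length (ws ! n) = js ! n + 2 \<and> hd (ws ! n) = last ((w # ws) ! n))"
proof -
  have le: "(\<forall>n\<le>N. P n) \<longleftrightarrow> P 0 \<and> (\<forall>n<N. P (Suc n))" for P
    using All_less_Suc2[of N P] by (simp add: less_Suc_eq_le)
  have "{1..N} = Suc ` {..<N}"
    by (simp add: image_Suc_lessThan)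
  then have ball: "(\<forall>n\<in>{1..N}. P n) \<longleftrightarrow> (\<forall>n<N. P (Suc n))" for P
    by auto
  show ?thesis
    unfolding path_tuples_def mem_Collect_eq le ball idx_def nth_Cons_0 nth_Cons_Suc diff_Suc_1
    by auto
qed

lemma Delta_factor:
  assumes "w # ws \<in> path_tuples N js" "length js = N" "n < N"
  shows "Delta p js (w # ws) (Suc n) *
       (\<Prod>i<idx js (Suc n). p (path_concat ((w # ws) ! n) (initial_path i ((w # ws) ! Suc n)))
                            ((w # ws) ! Suc n ! (i + 1)))
     = switch_weight (js ! n) ((w # ws) ! n) [last ((w # ws) ! n)] ((w # ws) ! Suc n)"
proof -
  let ?v = "ws ! n"
  have "length ?v = js ! n + 2" "hd ?v = last ((w # ws) ! n)"
    using assms(1,3) by (simp_all add: path_tuples_Cons[OF assms(2)])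
  then have v: "?v = last ((w # ws) ! n) # tl ?v" by (cases ?v) auto
  have "take (Suc i) ?v = last ((w # ws) ! n) # take i (tl ?v)" for i
    using v by (metis take_Suc_Cons)
  then show ?thesis
    by (simp add: Delta_def switch_weight_def continuation_prob_def idx_def path_concat_def
        initial_path_def)
qed

text \<open>
  The path \<open>(0, a)\<close> at the head of a tuple ranges over \<open>walks L 1 0\<close> up to terms that vanish because of the factor
  \<open>D(a)\<close>, and the others over \<open>linked_walks\<close> up to terms that vanish by \<open>switch_weight_outside\<close>.
\<close>

lemma infsum_path_tuples:
  assumes N: "length js = N" and Q: "is_walk_law p Q"
  shows "(\<Sum>\<^sub>\<infinity>ws\<in>path_tuples N js.
        (if last (ws ! N) = y then 1 else 0) * step_distr Q (ws ! 0 ! 1) *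
        (\<Prod>n=1..N. Delta p js ws n *
           (\<Prod>i<idx js n. p (path_concat (ws ! (n - 1)) (initial_path i (ws ! n)))
                            (ws ! n ! (i + 1)))))
    = (\<Sum>a\<in>nbhd L 0. p [0] a * iterated_switch js [0, a] (\<lambda>z. if z = y then 1 else 0))"
    (is "infsum ?F _ = _")
proof -
  let ?\<delta> = "\<lambda>z. if z = y then 1 else 0 :: real"
  define g where "g ws = p [0] (ws ! 0 ! 1) * (tuple_weight js ws * ?\<delta> (last (last ws)))" for ws
  define T where "T = (\<Union>v\<in>walks L (Suc 0) 0. (#) v ` linked_walks js (last v))"
  have in_T: "w # ws \<in> T \<longleftrightarrow> w \<in> walks L (Suc 0) 0 \<and> ws \<in> linked_walks js (last w)" for w ws
    by (auto simp: T_def)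
  have "infsum ?F (path_tuples N js) = infsum g T"
  proof (rule infsum_cong_neutral)
    fix ws0 assume "ws0 \<in> T - path_tuples N js"
    then show "g ws0 = 0"
      by (cases ws0)
        (auto simp: in_T path_tuples_Cons N linked_walks_iff walks_iff, auto simp: T_def)
  next
    have Fg: "?F ws0 = g ws0" if S: "ws0 \<in> path_tuples N js" for ws0
    proof -
      obtain w ws where ws0: "ws0 = w # ws"
        using S by (cases ws0) (auto simp: path_tuples_def)
      have "(w # ws) ! N = last (w # ws)"
        using S unfolding ws0 path_tuples_Cons[OF N] by (cases N) (auto simp: last_conv_nth)
      then show ?thesis
        unfolding One_nat_def prod.atLeast1_atMost_eq
        using Delta_factor[OF S[unfolded ws0] N]
        by (simp add: ws0 g_def tuple_weight_def N step_distr_eq_kernel[OF Q] del: nth_Cons_Suc)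
    qed
    {
      fix ws0 assume "ws0 \<in> path_tuples N js \<inter> T"
      then show "?F ws0 = g ws0" using Fg by blast
    next
      fix ws0 assume ws0': "ws0 \<in> path_tuples N js - T"
      then obtain w ws where ws0: "ws0 = w # ws"
        by (cases ws0) (auto simp: path_tuples_def)
      then have S: "w # ws \<in> path_tuples N js" and "w # ws \<notin> T" using ws0' by auto
      then consider "w \<notin> walks L (Suc 0) 0" | "ws \<notin> linked_walks js (last w)"
        using in_T by blast
      then have "g (w # ws) = 0"
      proof cases
        case 1
        then have "w ! 1 \<notin> nbhd L 0"
          using S by (cases w) (auto simp: path_tuples_Cons N walks_iff)
        then show ?thesis using kernel_outside[of "[0]"] by (simp add: g_def)
      next
        case 2
        then obtain n where n: "n < N" "ws ! n \<notin> walks L (Suc (js ! n)) (last ((w # ws) ! n))"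
          using S by (auto simp: path_tuples_Cons N linked_walks_iff)
        have "(w # ws) ! n \<noteq> []"
        proof (cases n)
          case 0
          then show ?thesis using S by (auto simp: path_tuples_Cons N)
        next
          case (Suc k)
          then have "length (ws ! k) = js ! k + 2"
            using S n(1) by (simp add: path_tuples_Cons N)
          then show ?thesis using Suc by auto
        qed
        then have "switch_weight (js ! n) ((w # ws) ! n) [last ((w # ws) ! n)] (ws ! n) = 0"
          using S n by (intro switch_weight_outside) (auto simp: path_tuples_Cons N)
        then have "tuple_weight js (w # ws) = 0"
          unfolding tuple_weight_def using n N by auto
        then show ?thesis by (simp add: g_def)
      qed
      then show "?F ws0 = 0" using Fg[OF S] unfolding ws0 by (rule trans[rotated])
    }
  qed
  also have "\<dots> = sum g T" by (rule infsum_finite) (simp add: T_def)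
  also have "\<dots> = (\<Sum>v\<in>walks L (Suc 0) 0. p [0] (v ! 1) * iterated_switch js v ?\<delta>)"
    unfolding T_def g_def iterated_switch_eq_sum
    by (subst sum_UN_Cons) (simp_all add: sum_distrib_left)
  also have "\<dots> = (\<Sum>a\<in>nbhd L 0. p [0] a * iterated_switch js [0, a] ?\<delta>)"
    unfolding sum_walks_Suc by simp
  finally show ?thesis .
qed

section \<open>The two-point function\<close>

text \<open>
  The law is only prescribed on cylinder events. Those of the finitely many paths in
  \<open>walks L n 0\<close> are disjoint, and their probabilities add up to the expectation of the constant \<open>1\<close>,
  which is \<open>1\<close>. They therefore exhaust the space up to a null set, and \<open>\<omega> n\<close> is constant on each.
\<close>

lemma two_point_eq_expect:
  assumes law: "is_walk_law p Q"
  shows "two_point Q n x = expect n [0] (\<lambda>z. if z = x then 1 else 0)"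
proof -
  interpret prob_space Q using law by (simp add: is_walk_law_def)
  have sQ: "sets Q = sets (PiM UNIV (\<lambda>_. count_space UNIV))"
    using law by (simp add: is_walk_law_def)
  have ev [measurable]: "{\<omega> \<in> space Q. \<omega> k = z} \<in> events" for k z
  proof -
    have "(\<lambda>\<omega>. \<omega> k) \<in> measurable Q (count_space UNIV)"
      by (subst measurable_cong_sets[OF sQ refl]) simp
    from measurable_sets[OF this, of "{z}"] show ?thesis
      by (simp add: vimage_def Int_def conj_commute)
  qed
  define E where "E v = {\<omega> \<in> space Q. \<forall>i<length v. \<omega> i = v ! i}" for v :: "'d path"
  have E [measurable]: "E v \<in> events" for v
  proof -
    have "{\<omega> \<in> space Q. \<forall>i\<in>{..<length v}. \<omega> i = v ! i} \<in> events"
      by (rule sets.sets_Collect_finite_All) (simp_all add: ev)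
    then show ?thesis by (simp add: E_def)
  qed
  let ?W = "walks L n 0"
  have prob_E: "prob (E v) = continuation_prob n [0] v" if v: "v \<in> ?W" for v
  proof -
    have "take (Suc i) v = 0 # take i (tl v)" for i
      using walks_eq_Cons[OF v] by (metis take_Suc_Cons)
    moreover have "prob (E v) = (\<Prod>i<length v - 1. p (take (Suc i) v) (v ! Suc i))"
      using law walks_nonempty[OF v] hd_walks[OF v] by (simp add: is_walk_law_def E_def)
    ultimately show ?thesis
      using length_walks[OF v] by (simp add: continuation_prob_def)
  qed
  have disj: "disjoint_family_on E ?W"
  proof (unfold disjoint_family_on_def, intro ballI impI)
    fix v w :: "'d path" assume vw: "v \<in> ?W" "w \<in> ?W" "v \<noteq> w"
    have False if "\<omega> \<in> E v" "\<omega> \<in> E w" for \<omega>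
    proof -
      have "v = w"
        using that length_walks[OF vw(1)] length_walks[OF vw(2)]
        by (intro nth_equalityI) (auto simp: E_def)
      then show False using vw(3) by simp
    qed
    then show "E v \<inter> E w = {}" by blast
  qed
  have "prob (\<Union>v\<in>?W. E v) = (\<Sum>v\<in>?W. prob (E v))"
    using disj by (intro finite_measure_finite_Union) auto
  also have "\<dots> = expect n [0] (\<lambda>_. 1)"
    unfolding expect_eq_sum_walks by (simp add: prob_E)
  also have "\<dots> = 1" by (simp add: expect_one)
  finally have "AE \<omega> in Q. \<omega> \<in> (\<Union>v\<in>?W. E v)"
    by (rule AE_prob_1)
  then have "two_point Q n x = prob (\<Union>v\<in>?W. E v \<inter> {\<omega> \<in> space Q. \<omega> n = x})"
    unfolding two_point_def by (intro finite_measure_eq_AE) (auto intro!: sets.finite_UN)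
  also have "\<dots> = (\<Sum>v\<in>?W. prob (E v \<inter> {\<omega> \<in> space Q. \<omega> n = x}))"
    using disj by (intro finite_measure_finite_Union) (auto simp: disjoint_family_on_def)
  also have "\<dots> = (\<Sum>v\<in>?W. continuation_prob n [0] v * (if last v = x then 1 else 0))"
  proof (rule sum.cong)
    fix v :: "'d path" assume v: "v \<in> ?W"
    have "\<omega> n = last v" if "\<omega> \<in> E v" for \<omega>
      using that length_walks[OF v] walks_nonempty[OF v] by (simp add: E_def last_conv_nth)
    moreover have "E v \<subseteq> space Q" by (auto simp: E_def)
    ultimately have "E v \<inter> {\<omega> \<in> space Q. \<omega> n = x} = (if last v = x then E v else {})"
      by auto
    then show "prob (E v \<inter> {\<omega> \<in> space Q. \<omega> n = x}) = continuation_prob n [0] v * (if last v = x then 1 else 0)"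
      using prob_E[OF v] by simp
  qed simp
  finally show ?thesis unfolding expect_eq_sum_walks by simp
qed

lemma two_point_shift:
  assumes "is_walk_law p Q" "translation_invariant p"
  shows "two_point Q n (x - y) = expect n [y] (\<lambda>z. if z = x then 1 else 0)"
proof -
  have "(\<lambda>z. if z = x - y then 1 else 0 :: real) = (\<lambda>z. if z + y = x then 1 else 0)"
    by (auto simp: fun_eq_iff algebra_simps)
  then show ?thesis
    using expect_shift[OF assms(2), of "[0]" n y "\<lambda>z. if z = x then 1 else 0"]
    by (simp add: two_point_eq_expect[OF assms(1)])
qed

section \<open>The recursion\<close>

definition first_step_switch :: "nat list \<Rightarrow> ('d site \<Rightarrow> real) \<Rightarrow> real" where
  "first_step_switch js f = (\<Sum>a\<in>nbhd L 0. p [0] a * iterated_switch js [0, a] f)"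

lemma first_step_switch_has_sum:
  "((\<lambda>y. first_step_switch js (\<lambda>z. if z = y then 1 else 0) * g y) has_sum first_step_switch js g) UNIV"
  unfolding first_step_switch_def sum_distrib_right mult.assoc
  by (rule has_sum_finite_sum[OF finite_nbhd], rule has_sum_cmult_right, rule iterated_switch_has_sum)

text \<open>
  The union of the sets \<open>index_set m N\<close> over \<open>N \<ge> 1\<close>. The summand \<open>1\<close> is the first step of the walk, which
  is not recorded in the list.
\<close>

definition pi_index :: "nat \<Rightarrow> nat list set" where
  "pi_index m = {js. js \<noteq> [] \<and> total_steps js + 1 = m}"

lemma finite_pi_index [simp]: "finite (pi_index m)"
  by (rule finite_subset[OF _ finite_bounded_index[of m]])
    (auto simp: pi_index_def bounded_index_def)

lemma pi_coeff_eq: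
  assumes "is_walk_law p Q"
  shows "pi_coeff p Q m y = (\<Sum>js\<in>pi_index m. first_step_switch js (\<lambda>z. if z = y then 1 else 0))"
proof -
  let ?S = "\<lambda>js. first_step_switch js (\<lambda>z. if z = y then 1 else 0)"
  have pi_N: "pi_N p Q N m y = (\<Sum>js\<in>index_set m N. ?S js)" for N
    unfolding pi_N_def first_step_switch_def
    by (intro sum.cong refl infsum_path_tuples assms) (simp add: index_set_def)
  have "index_set m N = {}" if "N > m" for N
    using that by (auto simp: index_set_def)
  then have "pi_coeff p Q m y = infsum (\<lambda>N. pi_N p Q N m y) {1..m}"
    unfolding pi_coeff_def by (intro infsum_cong_neutral) (auto simp: pi_N)
  also have "\<dots> = (\<Sum>N\<in>{1..m}. \<Sum>js\<in>index_set m N. ?S js)"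
    by (simp add: pi_N)
  also have "\<dots> = (\<Sum>N\<in>{1..m}. sum ?S {js \<in> pi_index m. length js = N})"
    by (intro sum.cong refl arg_cong[where f = "sum ?S"]) (auto simp: index_set_def pi_index_def)
  also have "\<dots> = (\<Sum>js\<in>pi_index m. ?S js)"
    by (rule sum.group[OF finite_pi_index]) (auto simp: pi_index_def Suc_le_eq)
  finally show ?thesis .
qed

lemma two_point_recursion:
  assumes law: "is_walk_law p Q" and ti: "translation_invariant p"
  shows "two_point Q (n + 1) x =
      (\<Sum>\<^sub>\<infinity>y\<in>UNIV. step_distr Q y * two_point Q n (x - y))
    + (\<Sum>\<^sub>\<infinity>y\<in>UNIV. \<Sum>m=2..n+1. pi_coeff p Q m y * two_point Q (n + 1 - m) (x - y))"
proof -
  let ?c = "\<lambda>k y. two_point Q k (x - y)"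
  let ?R = "\<lambda>js. first_step_switch js (?c (n - total_steps js))"
  have "two_point Q (n + 1) x
      = (\<Sum>a\<in>nbhd L 0. p [0] a * expect n [0, a] (\<lambda>z. if z = x then 1 else 0))"
    by (simp add: two_point_eq_expect[OF law])
  also have "\<dots> = (\<Sum>js\<in>bounded_index n. ?R js)"
    unfolding first_step_switch_def
    by (subst sum.swap, intro sum.cong refl, subst expect_expansion)
      (simp_all only: two_point_shift[OF law ti] sum_distrib_left, simp)
  also have "\<dots> = ?R [] + (\<Sum>js\<in>bounded_index n - {[]}. ?R js)"
    by (rule sum.remove[OF finite_bounded_index]) (simp add: bounded_index_def)
  also have "?R [] = (\<Sum>\<^sub>\<infinity>y\<in>UNIV. step_distr Q y * ?c n y)"
  proof -
    have "(\<Sum>\<^sub>\<infinity>y\<in>UNIV. step_distr Q y * ?c n y) = (\<Sum>\<^sub>\<infinity>y\<in>nbhd L 0. p [0] y * ?c n y)"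
      by (rule infsum_cong_neutral)
        (use kernel_outside[of "[0]"] in \<open>auto simp: step_distr_eq_kernel[OF law]\<close>)
    then show ?thesis by (simp add: first_step_switch_def)
  qed
  also have "(\<Sum>js\<in>bounded_index n - {[]}. ?R js)
     = (\<Sum>m=2..n+1. \<Sum>js\<in>pi_index m. first_step_switch js (?c (n + 1 - m)))"
  proof -
    have pos: "1 \<le> total_steps js" if "js \<noteq> []" for js
      using that by (cases js) auto
    have "(\<Sum>js\<in>bounded_index n - {[]}. ?R js)
       = (\<Sum>m=2..n+1. \<Sum>js | js \<in> bounded_index n - {[]} \<and> total_steps js + 1 = m. ?R js)"
    proof (rule sum.group[symmetric])
      show "(\<lambda>js. total_steps js + 1) ` (bounded_index n - {[]}) \<subseteq> {2..n + 1}"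
      proof (rule image_subsetI)
        fix js assume js: "js \<in> bounded_index n - {[]}"
        then have "1 \<le> total_steps js" by (intro pos) simp
        with js show "total_steps js + 1 \<in> {2..n + 1}"
          by (simp add: bounded_index_def)
      qed
    qed simp_all
    also have "\<dots> = (\<Sum>m=2..n+1. \<Sum>js\<in>pi_index m. first_step_switch js (?c (n + 1 - m)))"
      by (intro sum.cong refl) (auto simp: pi_index_def bounded_index_def)
    finally show ?thesis .
  qed
  also have "\<dots> = (\<Sum>\<^sub>\<infinity>y\<in>UNIV. \<Sum>m=2..n+1. pi_coeff p Q m y * ?c (n + 1 - m) y)"
    unfolding pi_coeff_eq[OF law] sum_distrib_right
    by (intro infsumI[symmetric] has_sum_finite_sum first_step_switch_has_sum) simp_all
  finally show ?thesis .
qed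

end

theorem mainTheorem1:
  fixes p :: "('d::finite) kernels"
    and L :: real
    and Q :: "(nat \<Rightarrow> 'd site) measure"
    and n :: nat
    and x :: "'d site"
  assumes "is_kernels p"
    and "translation_invariant p"
    and "finite_range L p"
    and "is_walk_law p Q"
  shows "two_point Q (n + 1) x =
      (\<Sum>\<^sub>\<infinity>y\<in>UNIV. step_distr Q y * two_point Q n (x - y))
    + (\<Sum>\<^sub>\<infinity>y\<in>UNIV. \<Sum>m=2..n+1. pi_coeff p Q m y * two_point Q (n + 1 - m) (x - y))"
proof -
  interpret finite_range_kernels p L
    using assms by unfold_locales
  show ?thesis using assms two_point_recursion by blast
qed

end
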